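(* For any connected graphs $G_1$ and $G_2$, $$pd(G_1\times G_2)\leq pd(G_1)+pd(G_2).$$
   Context: All graphs are finite, simple and connected. For a connected graph $G=(V,E)$, $d(u,v)$ denotes the length of a shortest $u$–$v$ path, and for $v\in V$ and nonempty $P\subseteq V$, $d(v,P)=\min\{d(v,x):x\in P\}$. For an ordered partition $\Pi=\{P_1,\dots,P_t\}$ of $V$, the partition representation of $v$ is $r(v|\Pi)=(d(v,P_1),\dots,d(v,P_t))$; $\Pi$ is a resolving partition if $r(u|\Pi)\neq r(v|\Pi)$ for all distinct $u,v\in V$. The partition dimension $pd(G)$ is the minimum number of sets in a resolving partition of $G$. The Cartesian product $G_1\times G_2$ of $G_1=(V_1,E_1)$ and $G_2=(V_2,E_2)$ has vertex set $V_1\times V_2$, with $(a,b)$ adjacent to $(c,d)$ iff either $a=c$ and $bd\in E_2$, or $b=d$ and $ac\in E_1$. *)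

theory Defs
  imports "Graph_Theory.Graph_Theory" "HOL-Library.Disjoint_Sets"
begin

text \<open>
  A finite simple graph is a \<^locale>\<open>pair_graph\<close>: a finite vertex set with a symmetric, loop-free
  set of arcs, each undirected edge \<open>uv\<close> being the two arcs \<open>(u, v)\<close> and \<open>(v, u)\<close>.
\<close>

definition graph_dist :: "'a pair_pre_digraph \<Rightarrow> 'a \<Rightarrow> 'a \<Rightarrow> nat" where
  "graph_dist G u v = (LEAST n. \<exists>p. pre_digraph.apath (with_proj G) u p v \<and> length p = n)"

definition graph_setdist :: "'a pair_pre_digraph \<Rightarrow> 'a \<Rightarrow> 'a set \<Rightarrow> nat" where
  "graph_setdist G v P = Min (graph_dist G v ` P)"

definition ordered_partition_on :: "'a set \<Rightarrow> 'a set list \<Rightarrow> bool" where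
  "ordered_partition_on V Ps \<longleftrightarrow> distinct Ps \<and> partition_on V (set Ps)"

definition partition_rep :: "'a pair_pre_digraph \<Rightarrow> 'a set list \<Rightarrow> 'a \<Rightarrow> nat list" where
  "partition_rep G Ps v = map (graph_setdist G v) Ps"

definition resolving_partition :: "'a pair_pre_digraph \<Rightarrow> 'a set list \<Rightarrow> bool" where
  "resolving_partition G Ps \<longleftrightarrow> ordered_partition_on (pverts G) Ps \<and>
     (\<forall>u \<in> pverts G. \<forall>v \<in> pverts G. u \<noteq> v \<longrightarrow> partition_rep G Ps u \<noteq> partition_rep G Ps v)"

definition partition_dim :: "'a pair_pre_digraph \<Rightarrow> nat" where
  "partition_dim G = (LEAST t. \<exists>Ps. resolving_partition G Ps \<and> length Ps = t)"

definition cartesian_product ::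
    "'a pair_pre_digraph \<Rightarrow> 'b pair_pre_digraph \<Rightarrow> ('a \<times> 'b) pair_pre_digraph" where
  "cartesian_product G1 G2 =
     \<lparr> pverts = pverts G1 \<times> pverts G2,
       parcs = {((a, b), (c, d)) | a b c d.
         (a, b) \<in> pverts G1 \<times> pverts G2 \<and> (c, d) \<in> pverts G1 \<times> pverts G2 \<and>
         (a = c \<and> (b, d) \<in> parcs G2 \<or> b = d \<and> (a, c) \<in> parcs G1)} \<rparr>"

text \<open>The minima in the definitions of distance and partition dimension are attained, and the product is
  again a finite simple graph.\<close>

lemma pair_graph_cartesian_product:
  assumes "pair_graph G1" and "pair_graph G2"
  shows "pair_graph (cartesian_product G1 G2)"
proof -
  interpret G1: pair_graph G1 by fact
  interpret G2: pair_graph G2 by fact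
  let ?H = "cartesian_product G1 G2"
  have fin: "finite (pverts ?H)"
    by (simp add: cartesian_product_def)
  have sub: "parcs ?H \<subseteq> pverts ?H \<times> pverts ?H"
    by (auto simp: cartesian_product_def)
  have s1: "(u, v) \<in> parcs G1 \<Longrightarrow> (v, u) \<in> parcs G1" for u v
    using G1.pair_sym_arcs by (auto simp: symmetric_def sym_def)
  have s2: "(u, v) \<in> parcs G2 \<Longrightarrow> (v, u) \<in> parcs G2" for u v
    using G2.pair_sym_arcs by (auto simp: symmetric_def sym_def)
  show ?thesis
  proof
    show "finite (parcs ?H)"
      using sub fin by (meson finite_SigmaI finite_subset)
    show "symmetric (with_proj ?H)"
      by (auto simp: symmetric_def sym_def cartesian_product_def intro: s1 s2)
    show "fst e \<noteq> snd e" if "e \<in> parcs ?H" for e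
      using that G1.no_loops' G2.no_loops' by (auto simp: cartesian_product_def)
  qed (use fin sub in auto)
qed

lemma graph_dist_attained:
  assumes "pair_graph G" and "Digraph_Component.connected (with_proj G)" and "u \<in> pverts G" and "v \<in> pverts G"
  shows "\<exists>p. pre_digraph.apath (with_proj G) u p v \<and> length p = graph_dist G u v"
proof -
  interpret pair_graph G by fact
  have "strongly_connected (with_proj G)"
    by (rule symmetric_connected_imp_strongly_connected[OF pair_sym_arcs assms(2)])
  then obtain q where "apath u q v"
    using assms(3,4) by (auto simp: strongly_connected_def reachable_apath)
  then have "\<exists>p. apath u p v \<and> length p = length q"
    by blast
  then show ?thesis
    unfolding graph_dist_def by (rule LeastI)
qed

lemma graph_dist_eq_0_iff:
  assumes "pair_graph G" and "Digraph_Component.connected (with_proj G)" and "u \<in> pverts G" and "v \<in> pverts G"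
  shows "graph_dist G u v = 0 \<longleftrightarrow> u = v"
proof -
  interpret pair_graph G by fact
  show ?thesis
  proof
    assume "graph_dist G u v = 0"
    then show "u = v"
      using graph_dist_attained[OF assms] by (auto simp: apath_Nil_iff)
  next
    assume "u = v"
    then have "\<exists>p. apath u p v \<and> length p = 0"
      using assms(3) by (auto simp: apath_Nil_iff)
    then show "graph_dist G u v = 0"
      unfolding graph_dist_def by (rule Least_eq_0)
  qed
qed

lemma partition_dim_attained:
  assumes "pair_graph G" and "Digraph_Component.connected (with_proj G)"
  shows "\<exists>Ps. resolving_partition G Ps \<and> length Ps = partition_dim G"
proof -
  interpret pair_graph G by fact
  obtain vs where vs: "set vs = pverts G" "distinct vs"
    using finite_distinct_list pair_finite_verts by blast
  let ?Ps = "map (\<lambda>v. {v}) vs"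
  have "partition_on (pverts G) ((\<lambda>v. {v}) ` pverts G)"
    by (auto simp: partition_on_def disjoint_def)
  then have "ordered_partition_on (pverts G) ?Ps"
    using vs by (auto simp: ordered_partition_on_def distinct_map inj_on_def)
  moreover have "partition_rep G ?Ps u \<noteq> partition_rep G ?Ps v"
    if "u \<in> pverts G" "v \<in> pverts G" "u \<noteq> v" for u v
  proof
    assume "partition_rep G ?Ps u = partition_rep G ?Ps v"
    then have "graph_dist G u u = graph_dist G v u"
      using that(1) vs by (auto simp: partition_rep_def graph_setdist_def)
    then show False
      using graph_dist_eq_0_iff[OF assms] that by metis
  qed
  ultimately have "\<exists>t Ps. resolving_partition G Ps \<and> length Ps = t"
    unfolding resolving_partition_def by blast
  then show ?thesis
    unfolding partition_dim_def by (rule LeastI_ex)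
qed

end

theory Submission
  imports Defs
begin

text \<open>
  Distances in the product are sums of distances in the factors, and the same holds for the distance
  to a set \<open>X \<times> Y\<close>. Take resolving partitions \<open>A\<^sub>1, \<dots>, A\<^sub>k\<close> and \<open>B\<^sub>1, \<dots>, B\<^sub>t\<close> of the factors, and
  partition the product into all \<open>A\<^sub>i \<times> B\<^sub>1\<close>, all \<open>A\<^sub>1 \<times> B\<^sub>j\<close> with \<open>j \<ge> 2\<close>, and the remaining set
  \<open>(V\<^sub>1 - A\<^sub>1) \<times> (V\<^sub>2 - B\<^sub>1)\<close> if it is nonempty: at most \<open>k + t\<close> classes. If \<open>(a, b)\<close> and \<open>(c, d)\<close> have the same
  representation, then \<open>dist(a, A\<^sub>i) - dist(c, A\<^sub>i)\<close> and \<open>dist(d, B\<^sub>j) - dist(b, B\<^sub>j)\<close> are all equal to one constant.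
  It is \<open>\<le> 0\<close> because \<open>a\<close> lies in some \<open>A\<^sub>i\<close>, and \<open>\<ge> 0\<close> because \<open>c\<close> does; so it vanishes, and
  \<open>a = c\<close>, \<open>b = d\<close>.
\<close>

section \<open>Distances measured by walks\<close>

text \<open>Cutting cycles out of a walk leaves a path that is no longer. Walks can thus replace the
  paths of the definition, and they concatenate freely even where vertices repeat.\<close>

lemma graph_dist_le_awalk:
  assumes "pair_graph G" and "pre_digraph.awalk (with_proj G) u p v"
  shows "graph_dist G u v \<le> length p"
proof -
  interpret pair_graph G by fact
  have "\<exists>q. apath u q v \<and> length q \<le> length p"
    using assms(2)
  proof (induction rule: awalk_to_apath_induct)
    case (path p)
    then show ?case by (auto simp: apath_def)
  next
    case (decomp p q r s)
    then have "length (q @ s) \<le> length p"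
      by (auto elim!: awalk_cyc_decompE)
    with decomp show ?case using order_trans by blast
  qed
  then show ?thesis
    unfolding graph_dist_def by (blast intro: Least_le order_trans)
qed

lemma graph_dist_attained_awalk:
  assumes "pair_graph G" and "Digraph_Component.connected (with_proj G)"
    and "u \<in> pverts G" and "v \<in> pverts G"
  obtains p where "pre_digraph.awalk (with_proj G) u p v" and "length p = graph_dist G u v"
  using graph_dist_attained[OF assms] by (auto simp: pre_digraph.apath_def)

text \<open>The walk \<open>p\<close> itself yields a path, so the least length is attained.
  Distances in the product can therefore be computed without first proving the product
  connected.\<close>

lemma graph_dist_eqI:
  assumes "pair_graph G" and "pre_digraph.awalk (with_proj G) u p v"
    and "\<And>q. pre_digraph.awalk (with_proj G) u q v \<Longrightarrow> length p \<le> length q"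
  shows "graph_dist G u v = length p"
proof -
  interpret pair_graph G by fact
  have "\<exists>n q. apath u q v \<and> length q = n"
    using apath_awalk_to_apath[OF assms(2)] by blast
  then have "\<exists>q. apath u q v \<and> length q = graph_dist G u v"
    unfolding graph_dist_def by (rule LeastI_ex)
  then have "length p \<le> graph_dist G u v"
    using assms(3) awalkI_apath by metis
  with graph_dist_le_awalk[OF assms(1,2)] show ?thesis by simp
qed

lemma graph_dist_arc:
  assumes "pair_graph G" and "Digraph_Component.connected (with_proj G)"
    and "(u, v) \<in> parcs G" and "w \<in> pverts G"
  shows "graph_dist G u w \<le> Suc (graph_dist G v w)"
proof -
  interpret pair_graph G by fact
  have "v \<in> pverts G" using assms(3) in_arcsD2 by blast
  then obtain p where p: "awalk v p w" "length p = graph_dist G v w"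
    using graph_dist_attained_awalk[OF assms(1,2) _ assms(4)] by metis
  then have "awalk u ((u, v) # p) w"
    using assms(3) by (simp add: awalk_Cons_iff)
  from graph_dist_le_awalk[OF assms(1) this] p show ?thesis by simp
qed

section \<open>Distances in the Cartesian product\<close>

lemma pverts_cartesian_product:
  "pverts (cartesian_product G1 G2) = pverts G1 \<times> pverts G2"
  by (simp add: cartesian_product_def)

text \<open>Freezing the second coordinate turns each arc of \<open>G1\<close> into an arc of the
  product. Together with its mirror image this gives the upper bound on product distances.\<close>

lemma awalk_cartesian_product_left:
  assumes "pair_graph G1" and "pair_graph G2"
    and "pre_digraph.awalk (with_proj G1) a p c" and "b \<in> pverts G2"
  shows "\<exists>q. pre_digraph.awalk (with_proj (cartesian_product G1 G2)) (a, b) q (c, b)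
    \<and> length q = length p"
proof -
  interpret G1: pair_graph G1 by fact
  interpret H: pair_graph "cartesian_product G1 G2"
    by (rule pair_graph_cartesian_product[OF assms(1,2)])
  show ?thesis using assms(3)
  proof (induction p arbitrary: a)
    case Nil
    then have "H.awalk (a, b) [] (c, b)"
      using assms(4) by (auto simp: H.awalk_Nil_iff G1.awalk_Nil_iff pverts_cartesian_product)
    then show ?case by auto
  next
    case (Cons e p)
    obtain a' where e: "e = (a, a')" "(a, a') \<in> parcs G1" "G1.awalk a' p c"
      using Cons.prems by (cases e) (auto simp: G1.awalk_Cons_iff)
    obtain q where q: "H.awalk (a', b) q (c, b)" "length q = length p"
      using Cons.IH[OF e(3)] by blast
    have "((a, b), (a', b)) \<in> parcs (cartesian_product G1 G2)"
      using e(2) assms(4) G1.in_arcsD1 G1.in_arcsD2 by (auto simp: cartesian_product_def)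
    then have "H.awalk (a, b) (((a, b), (a', b)) # q) (c, b)"
      using q by (simp add: H.awalk_Cons_iff)
    then show ?case using q(2) by (metis length_Cons)
  qed
qed

lemma awalk_cartesian_product_right:
  assumes "pair_graph G1" and "pair_graph G2"
    and "pre_digraph.awalk (with_proj G2) b p d" and "a \<in> pverts G1"
  shows "\<exists>q. pre_digraph.awalk (with_proj (cartesian_product G1 G2)) (a, b) q (a, d)
    \<and> length q = length p"
proof -
  interpret G2: pair_graph G2 by fact
  interpret H: pair_graph "cartesian_product G1 G2"
    by (rule pair_graph_cartesian_product[OF assms(1,2)])
  show ?thesis using assms(3)
  proof (induction p arbitrary: b)
    case Nil
    then have "H.awalk (a, b) [] (a, d)"
      using assms(4) by (auto simp: H.awalk_Nil_iff G2.awalk_Nil_iff pverts_cartesian_product)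
    then show ?case by auto
  next
    case (Cons e p)
    obtain b' where e: "e = (b, b')" "(b, b') \<in> parcs G2" "G2.awalk b' p d"
      using Cons.prems by (cases e) (auto simp: G2.awalk_Cons_iff)
    obtain q where q: "H.awalk (a, b') q (a, d)" "length q = length p"
      using Cons.IH[OF e(3)] by blast
    have "((a, b), (a, b')) \<in> parcs (cartesian_product G1 G2)"
      using e(2) assms(4) G2.in_arcsD1 G2.in_arcsD2 by (auto simp: cartesian_product_def)
    then have "H.awalk (a, b) (((a, b), (a, b')) # q) (a, d)"
      using q by (simp add: H.awalk_Cons_iff)
    then show ?case using q(2) by (metis length_Cons)
  qed
qed

text \<open>An arc of the product moves only one coordinate, so by \<open>graph_dist_arc\<close> the
  sum of the two distances to the target drops by at most one per arc.\<close>

lemma awalk_cartesian_product_length: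
  assumes "pair_graph G1" and "Digraph_Component.connected (with_proj G1)"
    and "pair_graph G2" and "Digraph_Component.connected (with_proj G2)"
    and "pre_digraph.awalk (with_proj (cartesian_product G1 G2)) (a, b) q (c, d)"
  shows "graph_dist G1 a c + graph_dist G2 b d \<le> length q"
proof -
  interpret H: pair_graph "cartesian_product G1 G2"
    by (rule pair_graph_cartesian_product[OF assms(1,3)])
  have "(c, d) \<in> pverts (cartesian_product G1 G2)"
    using H.awalk_last_in_verts[OF assms(5)] by simp
  then have cd: "c \<in> pverts G1" "d \<in> pverts G2"
    by (simp_all add: pverts_cartesian_product)
  show ?thesis using assms(5)
  proof (induction q arbitrary: a b)
    case Nil
    then show ?case
      using cd graph_dist_eq_0_iff[OF assms(1,2)] graph_dist_eq_0_iff[OF assms(3,4)]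
      by (auto simp: H.awalk_Nil_iff)
  next
    case (Cons e q)
    obtain a' b' where e: "((a, b), (a', b')) \<in> parcs (cartesian_product G1 G2)"
      and q: "H.awalk (a', b') q (c, d)"
      using Cons.prems by (cases e) (auto simp: H.awalk_Cons_iff)
    have "a = a' \<and> (b, b') \<in> parcs G2 \<or> b = b' \<and> (a, a') \<in> parcs G1"
      using e by (auto simp: cartesian_product_def)
    then show ?case
      using Cons.IH[OF q] graph_dist_arc[OF assms(1,2) _ cd(1)] graph_dist_arc[OF assms(3,4) _ cd(2)]
      by fastforce
  qed
qed

text \<open>A shortest walk to the corner \<open>(c, b)\<close> followed by one from there to
  \<open>(c, d)\<close> attains the lower bound of
  \<open>awalk_cartesian_product_length\<close>.\<close>

lemma graph_dist_cartesian_product: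
  assumes "pair_graph G1" and "Digraph_Component.connected (with_proj G1)"
    and "pair_graph G2" and "Digraph_Component.connected (with_proj G2)"
    and "a \<in> pverts G1" and "b \<in> pverts G2" and "c \<in> pverts G1" and "d \<in> pverts G2"
  shows "graph_dist (cartesian_product G1 G2) (a, b) (c, d) = graph_dist G1 a c + graph_dist G2 b d"
proof -
  interpret H: pair_graph "cartesian_product G1 G2"
    by (rule pair_graph_cartesian_product[OF assms(1,3)])
  obtain p1 where p1: "pre_digraph.awalk (with_proj G1) a p1 c" "length p1 = graph_dist G1 a c"
    using graph_dist_attained_awalk[OF assms(1,2,5,7)] by blast
  obtain p2 where p2: "pre_digraph.awalk (with_proj G2) b p2 d" "length p2 = graph_dist G2 b d"
    using graph_dist_attained_awalk[OF assms(3,4,6,8)] by blast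
  obtain q1 where q1: "H.awalk (a, b) q1 (c, b)" "length q1 = length p1"
    using awalk_cartesian_product_left[OF assms(1,3) p1(1) assms(6)] by blast
  obtain q2 where q2: "H.awalk (c, b) q2 (c, d)" "length q2 = length p2"
    using awalk_cartesian_product_right[OF assms(1,3) p2(1) assms(7)] by blast
  have len: "length (q1 @ q2) = graph_dist G1 a c + graph_dist G2 b d"
    using p1 p2 q1 q2 by simp
  have "H.awalk (a, b) (q1 @ q2) (c, d)"
    using q1 q2 by simp
  from graph_dist_eqI[OF H.pair_graph_axioms this]
  show ?thesis
    using awalk_cartesian_product_length[OF assms(1-4)] len by auto
qed

text \<open>Each summand of the product distance depends on one coordinate only, so the two minima
  over \<open>X\<close> and \<open>Y\<close> are attained together at a single point of the
  rectangle.\<close>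

lemma graph_setdist_cartesian_product:
  assumes "pair_graph G1" and "Digraph_Component.connected (with_proj G1)"
    and "pair_graph G2" and "Digraph_Component.connected (with_proj G2)"
    and "a \<in> pverts G1" and "b \<in> pverts G2"
    and "X \<subseteq> pverts G1" and "X \<noteq> {}" and "Y \<subseteq> pverts G2" and "Y \<noteq> {}"
  shows "graph_setdist (cartesian_product G1 G2) (a, b) (X \<times> Y) =
    graph_setdist G1 a X + graph_setdist G2 b Y"
proof -
  interpret G1: pair_graph G1 by fact
  interpret G2: pair_graph G2 by fact
  have fin: "finite X" "finite Y"
    using assms(7,9) G1.pair_finite_verts G2.pair_finite_verts finite_subset by blast+
  have dist: "graph_dist (cartesian_product G1 G2) (a, b) (x, y) = graph_dist G1 a x + graph_dist G2 b y"
    if "x \<in> X" "y \<in> Y" for x y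
    using graph_dist_cartesian_product[OF assms(1-6)] that assms(7,9) by blast
  have "Min (graph_dist G1 a ` X) \<in> graph_dist G1 a ` X"
    "Min (graph_dist G2 b ` Y) \<in> graph_dist G2 b ` Y"
    using fin assms(8,10) by (intro Min_in; simp)+
  then obtain x y where "x \<in> X" "Min (graph_dist G1 a ` X) = graph_dist G1 a x"
    "y \<in> Y" "Min (graph_dist G2 b ` Y) = graph_dist G2 b y"
    by blast
  note xy = this
  show ?thesis
    unfolding graph_setdist_def
  proof (rule Min_eqI)
    show "finite (graph_dist (cartesian_product G1 G2) (a, b) ` (X \<times> Y))"
      using fin by simp
    show "Min (graph_dist G1 a ` X) + Min (graph_dist G2 b ` Y)
        \<in> graph_dist (cartesian_product G1 G2) (a, b) ` (X \<times> Y)"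
      using xy dist by (auto intro!: image_eqI[where x = "(x, y)"])
    show "Min (graph_dist G1 a ` X) + Min (graph_dist G2 b ` Y) \<le> n"
      if "n \<in> graph_dist (cartesian_product G1 G2) (a, b) ` (X \<times> Y)" for n
      using that dist fin by (auto intro!: add_mono)
  qed
qed

lemma graph_setdist_eq_0:
  assumes "pair_graph G" and "Digraph_Component.connected (with_proj G)"
    and "P \<subseteq> pverts G" and "v \<in> P"
  shows "graph_setdist G v P = 0"
proof -
  interpret pair_graph G by fact
  have "finite P" using assms(3) pair_finite_verts finite_subset by blast
  moreover have "0 \<in> graph_dist G v ` P"
    using graph_dist_eq_0_iff[OF assms(1,2), of v v] assms(3,4) by force
  ultimately show ?thesis
    unfolding graph_setdist_def by (intro Min_eqI) auto
qed

section \<open>Resolving partitions and the partition of the product\<close>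

lemma resolving_partition_iff:
  "resolving_partition G Ps \<longleftrightarrow> ordered_partition_on (pverts G) Ps \<and>
     (\<forall>u \<in> pverts G. \<forall>v \<in> pverts G.
       (\<forall>P \<in> set Ps. graph_setdist G u P = graph_setdist G v P) \<longrightarrow> u = v)"
  by (auto simp: resolving_partition_def partition_rep_def)

text \<open>The nonemptiness filter only concerns the last class, which is empty when \<open>As\<close> or \<open>Bs\<close> is.\<close>

lemma ordered_partition_on_cross:
  assumes "ordered_partition_on V (A # As)" and "ordered_partition_on W (B # Bs)"
  shows "ordered_partition_on (V \<times> W)
    (map (\<lambda>X. X \<times> B) (A # As) @ map (\<lambda>Y. A \<times> Y) Bs @ filter (\<lambda>Z. Z \<noteq> {}) [(V - A) \<times> (W - B)])"
proof -
  let ?Rs = "filter (\<lambda>Z. Z \<noteq> {}) [(V - A) \<times> (W - B)]"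
  note part = assms[unfolded ordered_partition_on_def]
  have dist: "distinct (A # As)" "distinct (B # Bs)"
    and UV: "V = \<Union>(set (A # As))" and UW: "W = \<Union>(set (B # Bs))"
    using part by (simp_all only: partition_on_def)
  have NV: "X \<noteq> {}" if "X \<in> set (A # As)" for X
    using part(1) that unfolding partition_on_def by metis
  have NW: "Y \<noteq> {}" if "Y \<in> set (B # Bs)" for Y
    using part(2) that unfolding partition_on_def by metis
  have DV: "X = X'" if "x \<in> X" "x \<in> X'" "X \<in> set (A # As)" "X' \<in> set (A # As)" for x X X'
    using part(1) that unfolding partition_on_def disjoint_def by (metis disjoint_iff)
  have DW: "Y = Y'" if "y \<in> Y" "y \<in> Y'" "Y \<in> set (B # Bs)" "Y' \<in> set (B # Bs)" for y Y Y'
    using part(2) that unfolding partition_on_def disjoint_def by (metis disjoint_iff)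
  have AB: "A \<noteq> {}" "B \<noteq> {}" using NV NW by simp_all
  have notB: "y \<notin> B" if "y \<in> Y" "Y \<in> set Bs" for y Y
    using DW[of y Y B] that dist(2) by auto
  have disj: "P = Q" if "z \<in> P" "z \<in> Q"
    "P \<in> set (map (\<lambda>X. X \<times> B) (A # As) @ map (\<lambda>Y. A \<times> Y) Bs @ ?Rs)"
    "Q \<in> set (map (\<lambda>X. X \<times> B) (A # As) @ map (\<lambda>Y. A \<times> Y) Bs @ ?Rs)" for z P Q
  proof -
    obtain x y where z: "z = (x, y)" by (cases z)
    \<comment> \<open>The kind of class containing \<open>z\<close> is decided by whether
      \<open>y\<close> lies in \<open>B\<close> and, if not, whether \<open>x\<close> lies in
      \<open>A\<close>; within one kind, disjointness in the factor fixes the class.\<close>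
    have *: "(\<exists>X \<in> set (A # As). P = X \<times> B \<and> x \<in> X \<and> y \<in> B) \<or>
        (\<exists>Y \<in> set Bs. P = A \<times> Y \<and> x \<in> A \<and> y \<in> Y \<and> y \<notin> B) \<or>
        P = (V - A) \<times> (W - B) \<and> x \<notin> A \<and> y \<notin> B"
      if "z \<in> P" "P \<in> set (map (\<lambda>X. X \<times> B) (A # As) @ map (\<lambda>Y. A \<times> Y) Bs @ ?Rs)" for P
      using that z notB by (auto split: if_splits)
    show ?thesis
      using *[OF that(1,3)] *[OF that(2,4)] DV DW by (metis list.set_intros(2))
  qed
  have "distinct (map (\<lambda>X. X \<times> B) (A # As))" "distinct (map (\<lambda>Y. A \<times> Y) Bs)"
    using dist AB unfolding distinct_map by (auto simp: inj_on_def times_eq_iff)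
  moreover have "set (map (\<lambda>X. X \<times> B) (A # As)) \<inter> set (map (\<lambda>Y. A \<times> Y) Bs) = {}"
  proof -
    \<comment> \<open>Equality of nonempty rectangles would force \<open>B = Y\<close>, but
      \<open>B\<close> does not recur in \<open>Bs\<close>.\<close>
    have "X \<times> B \<noteq> A \<times> Y" if "X \<in> set (A # As)" "Y \<in> set Bs" for X Y
      using NV[OF that(1)] AB dist(2) that(2) by (auto simp: times_eq_iff)
    then show ?thesis unfolding set_map by blast
  qed
  moreover have "set (map (\<lambda>X. X \<times> B) (A # As)) \<inter> set ?Rs = {}"
  proof -
    \<comment> \<open>Equality would force \<open>B = W - B\<close>, impossible for nonempty
      \<open>B\<close>; the next block excludes \<open>A = V - A\<close> in the same way.\<close>
    have "X \<times> B \<noteq> (V - A) \<times> (W - B)" if "X \<in> set (A # As)" for X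
      using NV[OF that] AB by (auto simp: times_eq_iff)
    then show ?thesis unfolding set_map set_filter by auto
  qed
  moreover have "set (map (\<lambda>Y. A \<times> Y) Bs) \<inter> set ?Rs = {}"
  proof -
    have "A \<times> Y \<noteq> (V - A) \<times> (W - B)" if "Y \<in> set Bs" for Y
      using NW[of Y] that AB by (auto simp: times_eq_iff)
    then show ?thesis unfolding set_map set_filter by auto
  qed
  moreover have "distinct ?Rs" by simp
  ultimately have "distinct (map (\<lambda>X. X \<times> B) (A # As) @ map (\<lambda>Y. A \<times> Y) Bs @ ?Rs)"
    by (simp only: distinct_append set_append Int_Un_distrib Un_empty simp_thms)
  moreover have "\<Union>(set (map (\<lambda>X. X \<times> B) (A # As) @ map (\<lambda>Y. A \<times> Y) Bs @ ?Rs)) = V \<times> W"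
  proof -
    have "A \<subseteq> V" "B \<subseteq> W" using UV UW by auto
    then have "V \<times> W = V \<times> B \<union> A \<times> (W - B) \<union> (V - A) \<times> (W - B)"
      by blast
    moreover have "V \<times> B = \<Union>((\<lambda>X. X \<times> B) ` set (A # As))"
      using UV by blast
    moreover have "W - B = \<Union>(set Bs)"
      using UW notB by auto
    then have "A \<times> (W - B) = \<Union>((\<lambda>Y. A \<times> Y) ` set Bs)"
      by blast
    moreover have "\<Union>(set ?Rs) = (V - A) \<times> (W - B)"
      by auto
    ultimately show ?thesis
      by (simp only: set_append Union_Un_distrib set_map Un_assoc)
  qed
  moreover have "{} \<notin> set (map (\<lambda>X. X \<times> B) (A # As) @ map (\<lambda>Y. A \<times> Y) Bs @ ?Rs)"
  proof -
    have "X \<times> B \<noteq> {}" if "X \<in> set (A # As)" for X using NV[OF that] AB by simp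
    moreover have "A \<times> Y \<noteq> {}" if "Y \<in> set Bs" for Y using NW[of Y] that AB by simp
    ultimately show ?thesis unfolding set_append set_map set_filter by blast
  qed
  moreover have "disjoint (set (map (\<lambda>X. X \<times> B) (A # As) @ map (\<lambda>Y. A \<times> Y) Bs @ ?Rs))"
  proof (rule disjointI)
    fix P Q
    assume PQ: "P \<in> set (map (\<lambda>X. X \<times> B) (A # As) @ map (\<lambda>Y. A \<times> Y) Bs @ ?Rs)"
      "Q \<in> set (map (\<lambda>X. X \<times> B) (A # As) @ map (\<lambda>Y. A \<times> Y) Bs @ ?Rs)" "P \<noteq> Q"
    show "P \<inter> Q = {}"
      using disj[OF _ _ PQ(1,2)] PQ(3) by (meson disjoint_iff)
  qed
  ultimately show ?thesis
    by (simp only: ordered_partition_on_def partition_on_def simp_thms)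
qed

section \<open>Separating the vertices of the product\<close>

theorem theorem1:
  fixes G1 :: "'a pair_pre_digraph" and G2 :: "'b pair_pre_digraph"
  assumes "pair_graph G1" and "Digraph_Component.connected (with_proj G1)"
    and "pair_graph G2" and "Digraph_Component.connected (with_proj G2)"
  shows "partition_dim (cartesian_product G1 G2) \<le> partition_dim G1 + partition_dim G2"
proof -
  let ?H = "cartesian_product G1 G2"
  \<comment> \<open>Connectedness includes having a vertex; this supplies the first classes
    \<open>A\<close> and \<open>B\<close>.\<close>
  have ne: "pverts G1 \<noteq> {}" "pverts G2 \<noteq> {}"
    using assms(2,4) by (auto simp: Digraph_Component.connected_def strongly_connected_def)
  obtain Ps1 where Ps1: "resolving_partition G1 Ps1" "length Ps1 = partition_dim G1"
    using partition_dim_attained[OF assms(1,2)] by blast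
  obtain Ps2 where Ps2: "resolving_partition G2 Ps2" "length Ps2 = partition_dim G2"
    using partition_dim_attained[OF assms(3,4)] by blast
  have op: "ordered_partition_on (pverts G1) Ps1" "ordered_partition_on (pverts G2) Ps2"
    using Ps1 Ps2 by (auto simp: resolving_partition_def)
  then have U: "\<Union>(set Ps1) = pverts G1" "\<Union>(set Ps2) = pverts G2"
    and N: "{} \<notin> set Ps1" "{} \<notin> set Ps2"
    by (auto simp: ordered_partition_on_def partition_on_def)
  obtain A As where A: "Ps1 = A # As" using U(1) ne(1) by (cases Ps1) auto
  obtain B Bs where B: "Ps2 = B # Bs" using U(2) ne(2) by (cases Ps2) auto
  define Qs where "Qs = map (\<lambda>X. X \<times> B) (A # As) @ map (\<lambda>Y. A \<times> Y) Bs
    @ filter (\<lambda>Z. Z \<noteq> {}) [(pverts G1 - A) \<times> (pverts G2 - B)]"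
  \<comment> \<open>The cell \<open>A \<times> B\<close> is listed once, in the first block, and
    also covers the case \<open>Y = B\<close> of the second claim.\<close>
  have Qs_mem: "X \<times> B \<in> set Qs" "A \<times> Y \<in> set Qs" if "X \<in> set Ps1" "Y \<in> set Ps2" for X Y
    using that by (auto simp: Qs_def A B)
  have "ordered_partition_on (pverts ?H) Qs"
    using ordered_partition_on_cross op unfolding A B Qs_def pverts_cartesian_product by blast
  moreover have "u = v" if u: "u \<in> pverts ?H" and v: "v \<in> pverts ?H"
    and eq: "\<forall>P \<in> set Qs. graph_setdist ?H u P = graph_setdist ?H v P" for u v
  proof -
    obtain a b c d where uv: "u = (a, b)" "v = (c, d)"
      by (metis surj_pair)
    then have in_verts: "a \<in> pverts G1" "b \<in> pverts G2" "c \<in> pverts G1" "d \<in> pverts G2"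
      using u v by (simp_all add: pverts_cartesian_product)
    \<comment> \<open>Only rectangles with \<open>X = A\<close> or \<open>Y = B\<close> are classes
      of \<open>Qs\<close>, hence the side condition.\<close>
    have sum_eq: "graph_setdist G1 a X + graph_setdist G2 b Y = graph_setdist G1 c X + graph_setdist G2 d Y"
      if "X \<in> set Ps1" "Y \<in> set Ps2" "X = A \<or> Y = B" for X Y
    proof -
      have "graph_setdist ?H (a, b) (X \<times> Y) = graph_setdist ?H (c, d) (X \<times> Y)"
        using eq Qs_mem that by (auto simp: uv)
      moreover have "X \<subseteq> pverts G1" "X \<noteq> {}" "Y \<subseteq> pverts G2" "Y \<noteq> {}"
        using that U N by auto
      ultimately show ?thesis
        using in_verts by (simp add: graph_setdist_cartesian_product[OF assms])
    qed
    have A_mem: "A \<in> set Ps1" and B_mem: "B \<in> set Ps2" by (simp_all add: A B)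
    obtain X where X: "X \<in> set Ps1" "a \<in> X" using in_verts(1) U(1) by blast
    obtain X' where X': "X' \<in> set Ps1" "c \<in> X'" using in_verts(3) U(1) by blast
    have "graph_setdist G1 a X = 0" "graph_setdist G1 c X' = 0"
      using graph_setdist_eq_0[OF assms(1,2)] X X' U(1) by blast+
    \<comment> \<open>The class of \<open>a\<close> gives \<ge> between the two distances to
      \<open>B\<close>, and the class of \<open>c\<close> gives \<le>.\<close>
    then have B_eq: "graph_setdist G2 b B = graph_setdist G2 d B"
      using sum_eq[OF X(1) B_mem] sum_eq[OF X'(1) B_mem] by simp
    \<comment> \<open>The shared cell \<open>A \<times> B\<close> carries the equality over to the
      other factor.\<close>
    then have A_eq: "graph_setdist G1 a A = graph_setdist G1 c A"
      using sum_eq[OF A_mem B_mem] by simp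
    \<comment> \<open>With the distances to \<open>B\<close> cancelled, the classes
      \<open>X \<times> B\<close> show that \<open>a\<close> and \<open>c\<close> have the same
      distance to every class of \<open>Ps1\<close>.\<close>
    have "a = c"
      using Ps1(1) in_verts sum_eq[OF _ B_mem] B_eq by (simp add: resolving_partition_iff)
    moreover have "b = d"
      using Ps2(1) in_verts sum_eq[OF A_mem] A_eq by (simp add: resolving_partition_iff)
    ultimately show ?thesis by (simp add: uv)
  qed
  ultimately have "resolving_partition ?H Qs"
    by (auto simp: resolving_partition_iff)
  then have "partition_dim ?H \<le> length Qs"
    unfolding partition_dim_def by (intro Least_le) blast
  \<comment> \<open>Listing \<open>A \<times> B\<close> only once saves one class, which pays for
    the remaining set.\<close>
  also have "\<dots> \<le> length Ps1 + length Ps2"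
    by (simp add: Qs_def A B)
  finally show ?thesis using Ps1 Ps2 by simp
qed

end
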